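(* In the almost unobservable model of the stochastic clearing system in alternating environment, a dominant strategy always exists. Let $$V_{au}^{min}=\frac{\min(\mu_1,\mu_2)+q_{21}+q_{12}}{\mu_1\mu_2+\mu_1 q_{21}+\mu_2 q_{12}},\qquad V_{au}^{max}=\frac{\max(\mu_1,\mu_2)+q_{21}+q_{12}}{\mu_1\mu_2+\mu_1 q_{21}+\mu_2 q_{12}}.$$ If $\mu_1\neq\mu_2$, then $V_{au}^{min}<V_{au}^{max}$, and the dominant strategies $(q_1,q_2)$ are: - if $\frac RC<V_{au}^{min}$: $(0,0)$; - if $\frac RC=V_{au}^{min}$: $(0,q_2)$ with $q_2\in[0,1]$ when $\mu_1<\mu_2$; $(q_1,0)$ with $q_1\in[0,1]$ when $\mu_1>\mu_2$; - if $V_{au}^{min}<\frac RC<V_{au}^{max}$: $(0,1)$ when $\mu_1<\mu_2$; $(1,0)$ when $\mu_1>\mu_2$; - if $\frac RC=V_{au}^{max}$: $(q_1,1)$ with $q_1\in[0,1]$ when $\mu_1<\mu_2$; $(1,q_2)$ with $q_2\in[0,1]$ when $\mu_1>\mu_2$; - if $\frac RC>V_{au}^{max}$: $(1,1)$. If $\mu_1=\mu_2$, then $V_{au}^{min}=V_{au}^{max}=:V_{au}$, and the dominant strategies are: - if $\frac RC<V_{au}$: $(0,0)$; - if $\frac RC=V_{au}$: every $(q_1,q_2)$ with $q_1,q_2\in[0,1]$; - if $\frac RC>V_{au}$: $(1,1)$.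
   Context: Model. Parameters $\lambda_1,\lambda_2,\mu_1,\mu_2,q_{12},q_{21},R,C$ are positive reals. The environment $E(t)$ is a continuous-time Markov chain on $\{1,2\}$ with transition rate $q_{12}$ from 1 to 2 and $q_{21}$ from 2 to 1. While the environment is in state $e$, customers arrive according to a Poisson process of rate $\lambda_e$ and, independently, a facility visits according to a Poisson process of rate $\mu_e$; at each visit all present customers are served instantaneously and removed. A customer who joins receives reward $R$ and pays cost $C$ per unit of time spent in the system; a customer who balks gets $0$. Decisions are irrevocable. Almost unobservable case. An arriving customer observes the environment state but not the number of customers. A strategy is a pair $(q_1,q_2)\in[0,1]^2$, where $q_e$ is the probability of joining when the environment upon arrival is $e$. The system is in steady state: an arriving customer finds the environment in state $e$ with probability $\frac{\lambda_e p_E(e)}{\lambda_1p_E(1)+\lambda_2p_E(2)}$, where $p_E(1)=\frac{q_{21}}{q_{12}+q_{21}}$, $p_E(2)=\frac{q_{12}}{q_{12}+q_{21}}$. The sojourn time of a customer who joins when the environment is $e$ is the time $S_e$ until the next visit of the facility, i.e. the first point of the visit process (intensity $\mu_{E(t)}$) when $E(0)=e$. The payoff of a tagged customer using $(q_1,q_2)$ when all others use $(q_1',q_2')$ is $$\mathcal U\bigl((q_1,q_2),(q_1',q_2')\bigr)=\sum_{e=1}^{2}\frac{\lambda_e p_E(e)}{\lambda_1p_E(1)+\lambda_2p_E(2)}\,q_e\bigl(R-C\,\mathbb E[S_e]\bigr).$$ A strategy $s_*$ is dominant if $\mathcal U(s_*,s)\ge\mathcal U(s',s)$ for all strategies $s',s$.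 *)

theory Defs
  imports "HOL-Probability.Probability"
begin

datatype env = Env1 | Env2

lemma UNIV_env: "UNIV = {Env1, Env2}"
  by (auto intro: env.exhaust)

instance env :: finite
  by standard (simp add: UNIV_env)

definition transition_function :: "(real \<Rightarrow> 's::finite \<Rightarrow> 's \<Rightarrow> real) \<Rightarrow> bool" where
  "transition_function p \<longleftrightarrow>
     (\<forall>t\<ge>0. \<forall>i j. 0 \<le> p t i j) \<and>
     (\<forall>t\<ge>0. \<forall>i. (\<Sum>j\<in>UNIV. p t i j) = 1) \<and>
     (\<forall>i j. p 0 i j = (if i = j then 1 else 0)) \<and>
     (\<forall>s\<ge>0. \<forall>t\<ge>0. \<forall>i j. p (s + t) i j = (\<Sum>k\<in>UNIV. p s i k * p t k j))"

text \<open>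
  Time is \<open>[0, \<infinity>)\<close>, embedded in \<^typ>\<open>real\<close>; the values of a process at negative times are ignored.
  The transition rates are \<open>q i j\<close> for \<open>i \<noteq> j\<close>; the diagonal entries of \<open>q\<close> are ignored.
  Paths are right-continuous for the discrete topology on the state space.
\<close>

definition ctmc ::
  "'a measure \<Rightarrow> (real \<Rightarrow> 'a \<Rightarrow> 's::finite) \<Rightarrow> 's \<Rightarrow> ('s \<Rightarrow> 's \<Rightarrow> real) \<Rightarrow> bool" where
  "ctmc M X i0 q \<longleftrightarrow>
     (\<forall>t\<ge>0. X t \<in> measurable M (count_space UNIV)) \<and>
     (\<forall>\<omega>\<in>space M. \<forall>t\<ge>0. \<forall>\<^sub>F u in at_right t. X u \<omega> = X t \<omega>) \<and>
     (AE \<omega> in M. X 0 \<omega> = i0) \<and>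
     (\<exists>p. transition_function p \<and>
        (\<forall>i j. i \<noteq> j \<longrightarrow> ((\<lambda>h. p h i j / h) \<longlongrightarrow> q i j) (at_right 0)) \<and>
        (\<forall>(n::nat) t s j.
           0 \<le> t 0 \<and> (\<forall>k\<le>n. t k < t (Suc k)) \<and>
           0 < \<P>(\<omega> in M. \<forall>k\<le>n. X (t k) \<omega> = s k) \<longrightarrow>
           \<P>(\<omega> in M. X (t (Suc n)) \<omega> = j \<bar> \<forall>k\<le>n. X (t k) \<omega> = s k)
             = p (t (Suc n) - t n) (s n) j))"

definition path_algebra :: "'a measure \<Rightarrow> (real \<Rightarrow> 'a \<Rightarrow> 's) \<Rightarrow> 'a measure" where
  "path_algebra M X = sigma (space M) {X t -` A \<inter> space M | t A. 0 \<le> t}"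

text \<open>
  \<open>N t\<close> is the number of points in \<open>(0, t]\<close>. Given the whole path of \<open>X\<close>, the points form a
  Poisson process with intensity \<open>m (X u)\<close> at time \<open>u\<close>: the conditional law of the increments is
  that of independent Poisson variables whose means are the integrals of the intensity. The
  Poisson weights are written out because \<^const>\<open>poisson_pmf\<close> is only specified for positive means.
\<close>

definition modulated_poisson ::
  "'a measure \<Rightarrow> (real \<Rightarrow> 'a \<Rightarrow> 's) \<Rightarrow> ('s \<Rightarrow> real) \<Rightarrow> (real \<Rightarrow> 'a \<Rightarrow> nat) \<Rightarrow> bool" where
  "modulated_poisson M X m N \<longleftrightarrow>
     (\<forall>t\<ge>0. N t \<in> measurable M (count_space UNIV)) \<and>
     (\<forall>\<omega>\<in>space M. N 0 \<omega> = 0 \<and> mono_on {0..} (\<lambda>t. N t \<omega>) \<and>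
        (\<forall>t\<ge>0. \<forall>\<^sub>F u in at_right t. N u \<omega> = N t \<omega>)) \<and>
     (\<forall>(n::nat) t (k::nat \<Rightarrow> nat). 0 \<le> t 0 \<and> (\<forall>i<n. t i \<le> t (Suc i)) \<longrightarrow>
        (AE \<omega> in M.
           real_cond_exp M (path_algebra M X)
             (indicator {\<omega> \<in> space M. \<forall>i<n. N (t (Suc i)) \<omega> = N (t i) \<omega> + k i}) \<omega>
           = (\<Prod>i<n. let \<Lambda> = (LBINT u:{t i..t (Suc i)}. m (X u \<omega>))
                     in \<Lambda> ^ k i / fact (k i) * exp (- \<Lambda>))))"

text \<open>The value is \<open>\<infinity>\<close> on paths without any point.\<close>

definition first_visit :: "(real \<Rightarrow> 'a \<Rightarrow> nat) \<Rightarrow> 'a \<Rightarrow> ennreal" where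
  "first_visit N \<omega> = (INF t\<in>{t. 0 < t \<and> 1 \<le> N t \<omega>}. ennreal t)"

text \<open>
  For positive transition rates and intensities the expectation is finite, so that
  \<^const>\<open>enn2real\<close> loses nothing.
\<close>

definition mean_sojourn :: "'a measure \<Rightarrow> (real \<Rightarrow> 'a \<Rightarrow> nat) \<Rightarrow> real" where
  "mean_sojourn M N = enn2real (\<integral>\<^sup>+\<omega>. first_visit N \<omega> \<partial>M)"

fun p_env :: "(env \<Rightarrow> env \<Rightarrow> real) \<Rightarrow> env \<Rightarrow> real" where
  "p_env q Env1 = q Env2 Env1 / (q Env1 Env2 + q Env2 Env1)"
| "p_env q Env2 = q Env1 Env2 / (q Env1 Env2 + q Env2 Env1)"

definition p_arrival :: "(env \<Rightarrow> real) \<Rightarrow> (env \<Rightarrow> env \<Rightarrow> real) \<Rightarrow> env \<Rightarrow> real" where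
  "p_arrival lam q e =
     lam e * p_env q e / (lam Env1 * p_env q Env1 + lam Env2 * p_env q Env2)"

type_synonym strategy = "real \<times> real"

definition strategies :: "strategy set" where
  "strategies = {0..1} \<times> {0..1}"

fun join_prob :: "strategy \<Rightarrow> env \<Rightarrow> real" where
  "join_prob (q1, q2) Env1 = q1"
| "join_prob (q1, q2) Env2 = q2"

text \<open>
  The argument \<open>ES e\<close> is the mean sojourn time of a customer who joins in environment \<open>e\<close>. The
  payoff of the tagged customer, who follows \<open>s\<close>, does not depend on the strategy \<open>s'\<close> of the others.
\<close>

definition payoff ::
  "(env \<Rightarrow> real) \<Rightarrow> (env \<Rightarrow> env \<Rightarrow> real) \<Rightarrow> real \<Rightarrow> real \<Rightarrow> (env \<Rightarrow> real) \<Rightarrow>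
   strategy \<Rightarrow> strategy \<Rightarrow> real" where
  "payoff lam q R C ES s s' =
     (\<Sum>e\<in>UNIV. p_arrival lam q e * join_prob s e * (R - C * ES e))"

definition dominant :: "(strategy \<Rightarrow> strategy \<Rightarrow> real) \<Rightarrow> strategy \<Rightarrow> bool" where
  "dominant U s0 \<longleftrightarrow>
     s0 \<in> strategies \<and> (\<forall>s'\<in>strategies. \<forall>s\<in>strategies. U s0 s \<ge> U s' s)"

definition Vau_min :: "(env \<Rightarrow> real) \<Rightarrow> (env \<Rightarrow> env \<Rightarrow> real) \<Rightarrow> real" where
  "Vau_min mu q =
     (min (mu Env1) (mu Env2) + q Env2 Env1 + q Env1 Env2) /
     (mu Env1 * mu Env2 + mu Env1 * q Env2 Env1 + mu Env2 * q Env1 Env2)"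

definition Vau_max :: "(env \<Rightarrow> real) \<Rightarrow> (env \<Rightarrow> env \<Rightarrow> real) \<Rightarrow> real" where
  "Vau_max mu q =
     (max (mu Env1) (mu Env2) + q Env2 Env1 + q Env1 Env2) /
     (mu Env1 * mu Env2 + mu Env1 * q Env2 Env1 + mu Env2 * q Env1 Env2)"

end

theory Submission
  imports Defs
begin

text \<open>
  The payoff is a sum over the two environments, each term linear in the corresponding joining
  probability and free of the strategies of the others. A strategy is therefore dominant if and only
  if in each environment \<open>e\<close> it joins surely when \<open>R / C\<close> exceeds the mean sojourn time \<open>W e\<close>, balks surely
  when \<open>R / C\<close> is smaller, and is arbitrary when they are equal (\<open>dominant_payoff_iff\<close>). The theorem is
  this dichotomy, once it is known that the mean sojourn times are the two thresholds: \<open>W e\<close> is the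
  quotient with the visit rate of the other environment in the numerator, so the larger threshold
  belongs to the environment with the lower visit rate.

  The substance is the computation of the mean sojourn time (\<open>mean_sojourn_first_step\<close>): for a finite
  chain with rates \<open>q\<close> and visit intensities \<open>m > 0\<close>, it equals \<open>w i0\<close> for the solution \<open>w\<close> of the
  first-step equations \<open>m i * w i - (\<Sum>j\<in>-{i}. q i j * (w j - w i)) = 1\<close>. The usual argument
  conditions on the first jump or visit and restarts both processes there. The argument here works with the
  finite-dimensional distributions of the chain, the right-continuity of the paths and the conditional law
  of the visits given the environment. The mean sojourn time is the integral over \<open>t\<close> of the probability of no visit up
  to time \<open>t\<close> (\<open>nn_integral_tail\<close>), and this probability is the mean of \<open>exp (- A)\<close>, where \<open>A\<close> is the
  integral of the intensity along the environment path (\<open>void_probability\<close>).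

  When \<open>A\<close> is replaced by a Riemann sum of mesh \<open>h\<close> (\<open>path_integral_limit\<close>), the mean becomes
  a power of the matrix \<open>K i j = p h i j * exp (- (h * m j))\<close> applied to the constant 1
  (\<open>grid_expectation\<close>), and the integral over \<open>t\<close> becomes \<open>h\<close> times the Neumann series of \<open>K\<close>. Since \<open>K\<close> is
  the identity plus \<open>h\<close> times the killed generator up to a smaller error (\<open>killed_generator\<close>), the vector
  \<open>w - K w\<close> is nearly the constant \<open>h\<close>, and a comparison of Neumann series (\<open>substochastic_resolvent\<close>)
  shows that \<open>h * (\<Sum>k. (K ^^ k) 1)\<close> tends to \<open>w\<close> as \<open>h\<close> tends to 0.
\<close>

section \<open>Path integrals as limits of Riemann sums\<close>

text \<open>
  The index \<open>k\<close> of the cell \<open>(k * h, (k + 1) * h]\<close> that contains \<open>u > 0\<close>. The cells are open on the left,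
  so that the right endpoints of the cells of \<open>u\<close> approach \<open>u\<close> from the right when the mesh tends to 0,
  and the values of a right-continuous path there tend to its value at \<open>u\<close>.
\<close>

definition cell :: "real \<Rightarrow> real \<Rightarrow> nat" where
  "cell h u = nat \<lceil>u / h\<rceil> - 1"

lemma cell_eq_iff:
  assumes "0 < h" "0 < u"
  shows "cell h u = k \<longleftrightarrow> real k * h < u \<and> u \<le> real (Suc k) * h"
proof -
  have c: "1 \<le> \<lceil>u / h\<rceil>"
    using assms by (simp add: le_ceiling_iff)
  have "cell h u = k \<longleftrightarrow> \<lceil>u / h\<rceil> = int k + 1"
    using c unfolding cell_def by linarith
  also have "\<dots> \<longleftrightarrow> real k < u / h \<and> u / h \<le> real (Suc k)"
    by (simp add: ceiling_eq_iff add.commute)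
  also have "\<dots> \<longleftrightarrow> real k * h < u \<and> u \<le> real (Suc k) * h"
    using assms by (simp add: field_simps)
  finally show ?thesis .
qed

lemma
  assumes "0 < h" "0 < u"
  shows cell_lower: "real (cell h u) * h < u"
    and cell_upper: "u \<le> real (Suc (cell h u)) * h"
  using cell_eq_iff[OF assms, of "cell h u"] by blast+

lemma indicator_cell:
  assumes "0 < h" "0 < u"
  shows "indicator {real k * h<..real (Suc k) * h} u = (if k = cell h u then 1 else 0)"
  using cell_eq_iff[OF assms, of k] by (auto simp: indicator_def)

lemma right_limit_along:
  fixes x :: "real \<Rightarrow> 's"
  assumes "\<forall>\<^sub>F v in at_right u. x v = x u" "r \<longlonglongrightarrow> u" "\<And>n. u \<le> r n"
  shows "\<forall>\<^sub>F n in sequentially. x (r n) = x u"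
proof -
  obtain b where b: "u < b" "\<And>v. u < v \<Longrightarrow> v < b \<Longrightarrow> x v = x u"
    using assms(1) unfolding eventually_at_right_field by blast
  have "\<forall>\<^sub>F n in sequentially. r n < b"
    using assms(2) b(1) by (rule order_tendstoD)
  then show ?thesis
    by eventually_elim (metis assms(3) b(2) order_le_less)
qed

text \<open>
  The paths need not have left limits. With right endpoints as tags, right-continuity alone makes the step
  functions agree with the path at each fixed \<open>u\<close> in \<open>(0, t)\<close> once the grid is fine enough. Dominated
  convergence then applies; the path is measurable as a limit of step functions.
\<close>

lemma path_integral_limit:
  fixes x :: "real \<Rightarrow> 's" and f :: "'s \<Rightarrow> real"
  assumes rc: "\<And>u. 0 \<le> u \<Longrightarrow> \<forall>\<^sub>F v in at_right u. x v = x u"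
    and B: "\<And>s. \<bar>f s\<bar> \<le> B"
    and h: "\<And>n. 0 < h n" "h \<longlonglongrightarrow> 0" and t: "0 < t"
  shows "(\<lambda>n. h n * (\<Sum>k<cell (h n) t. f (x (real (Suc k) * h n))))
           \<longlonglongrightarrow> (LBINT u:{0..t}. f (x u))"
proof -
  define g where "g n u = (\<Sum>k<cell (h n) t. f (x (real (Suc k) * h n)) *
     indicator {real k * h n<..real (Suc k) * h n} u)" for n u
  define \<phi> where "\<phi> u = indicator {0<..<t} u * f (x u)" for u
  have g_val: "g n u = (if cell (h n) u < cell (h n) t then f (x (real (Suc (cell (h n) u)) * h n)) else 0)"
    if "0 < u" for n u
    unfolding g_def indicator_cell[OF h(1) that]
    by (simp add: if_distrib sum.delta cong: if_cong)
  have g_nonpos: "g n u = 0" if "u \<le> 0" for n u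
    unfolding g_def
  proof (intro sum.neutral ballI)
    fix k
    have "0 \<le> real k * h n" using h(1)[of n] by simp
    then show "f (x (real (Suc k) * h n)) * indicator {real k * h n<..real (Suc k) * h n} u = 0"
      using that by (simp add: indicator_def)
  qed
  have mono: "u < t" if "0 < u" "cell (h n) u < cell (h n) t" for n u
  proof -
    have "u \<le> real (Suc (cell (h n) u)) * h n" using cell_upper[OF h(1) that(1)] .
    also have "\<dots> \<le> real (cell (h n) t) * h n" using that(2) h(1)[of n] by (intro mult_right_mono) auto
    also have "\<dots> < t" using cell_lower[OF h(1) t] .
    finally show ?thesis .
  qed
  have lim: "(\<lambda>n. g n u) \<longlonglongrightarrow> \<phi> u" for u
  proof (cases "0 < u \<and> u < t")
    case True
    have r: "(\<lambda>n. real (Suc (cell (h n) u)) * h n) \<longlonglongrightarrow> u"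
    proof (rule tendsto_sandwich[of "\<lambda>_. u" _ _ "\<lambda>n. u + h n"])
      show "\<forall>\<^sub>F n in sequentially. u \<le> real (Suc (cell (h n) u)) * h n"
        using cell_upper[OF h(1)] True by simp
      show "\<forall>\<^sub>F n in sequentially. real (Suc (cell (h n) u)) * h n \<le> u + h n"
        using cell_lower[OF h(1)] True by (auto intro!: always_eventually simp: algebra_simps less_imp_le)
      show "(\<lambda>n. u + h n) \<longlonglongrightarrow> u" using tendsto_add[OF tendsto_const h(2)] by simp
    qed simp
    have "\<forall>\<^sub>F n in sequentially. h n < t - u"
      using order_tendstoD(2)[OF h(2)] True by simp
    then have ev1: "\<forall>\<^sub>F n in sequentially. cell (h n) u < cell (h n) t"
    proof eventually_elim
      case (elim n)
      have "real (cell (h n) u) * h n < u" using cell_lower[OF h(1)] True by simp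
      moreover have "t \<le> real (Suc (cell (h n) t)) * h n" using cell_upper[OF h(1) t] .
      ultimately have "real (cell (h n) u) * h n < real (cell (h n) t) * h n"
        using elim by (simp add: algebra_simps)
      then show ?case using h(1)[of n] by simp
    qed
    have ev2: "\<forall>\<^sub>F n in sequentially. x (real (Suc (cell (h n) u)) * h n) = x u"
      by (rule right_limit_along[OF rc r cell_upper[OF h(1)]]) (use True in auto)
    have "\<forall>\<^sub>F n in sequentially. g n u = \<phi> u"
      using ev1 ev2 by eventually_elim (use True in \<open>simp add: g_val \<phi>_def\<close>)
    then show ?thesis by (rule tendsto_eventually)
  next
    case False
    have "g n u = 0" for n
      using g_val[of u n] g_nonpos[of u n] mono[of u n] False by (cases "u \<le> 0") auto
    moreover have "\<phi> u = 0" using False by (auto simp: \<phi>_def)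
    ultimately show ?thesis by simp
  qed
  have g_meas: "g n \<in> borel_measurable lborel" for n
    unfolding g_def by measurable
  have \<phi>_meas: "\<phi> \<in> borel_measurable lborel"
    by (rule borel_measurable_LIMSEQ_real[OF lim g_meas])
  have B0: "0 \<le> B" using B[of undefined] by linarith
  have bound: "norm (g n u) \<le> B * indicator {0..t} u" for n u
    using g_val[of u n] g_nonpos[of u n] mono[of u n] B B0
    by (cases "u \<le> 0") (auto simp: indicator_def)
  have int: "(\<lambda>n. \<integral>u. g n u \<partial>lborel) \<longlonglongrightarrow> (\<integral>u. \<phi> u \<partial>lborel)"
    by (rule integral_dominated_convergence[where w="\<lambda>u. B * indicator {0..t} u"])
       (use lim bound g_meas \<phi>_meas in \<open>auto intro!: integrable_real_indicator integrable_mult_right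
          simp: emeasure_lborel_Icc_eq\<close>)
  have "(\<integral>u. g n u \<partial>lborel) = h n * (\<Sum>k<cell (h n) t. f (x (real (Suc k) * h n)))" for n
  proof -
    have i: "integrable lborel (indicator {real k * h n<..real (Suc k) * h n} :: real \<Rightarrow> real)" for k
      using h(1)[of n] by (intro integrable_real_indicator) (auto simp: mult_right_mono)
    have "(\<integral>u. g n u \<partial>lborel) = (\<Sum>k<cell (h n) t. f (x (real (Suc k) * h n)) * h n)"
      unfolding g_def using h(1)[of n] i
      by (subst Bochner_Integration.integral_sum) (auto intro!: sum.cong integrable_mult_right simp: algebra_simps measure_def)
    then show ?thesis by (simp add: sum_distrib_left mult.commute)
  qed
  moreover have "(\<integral>u. \<phi> u \<partial>lborel) = (LBINT u:{0..t}. f (x u))"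
    using interval_integral_Icc[of 0 t "\<lambda>u. f (x u)"] interval_integral_Ioo[of 0 t "\<lambda>u. f (x u)"] t
    by (simp add: \<phi>_def set_lebesgue_integral_def zero_ereal_def)
  ultimately show ?thesis using int by simp
qed

section \<open>Substochastic matrices\<close>

text \<open>
  The action of a matrix on functions on the state space, that is, on column vectors. As an operator it can
  be iterated with \<open>^^\<close>.
\<close>

definition averaging :: "('s::finite \<Rightarrow> 's \<Rightarrow> real) \<Rightarrow> ('s \<Rightarrow> real) \<Rightarrow> 's \<Rightarrow> real" where
  "averaging K f i = (\<Sum>j\<in>UNIV. K i j * f j)"

lemma averaging_mono:
  assumes "\<And>i j. 0 \<le> K i j" "\<And>i. f i \<le> g i"
  shows "averaging K f i \<le> averaging K g i"
  unfolding averaging_def by (intro sum_mono mult_left_mono assms)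

lemma substochastic_power_bound:
  assumes K: "\<And>i j. 0 \<le> K i j" "\<And>i. (\<Sum>j\<in>UNIV. K i j) \<le> \<theta>" and \<theta>: "0 \<le> \<theta>"
    and f: "\<And>i. \<bar>f i\<bar> \<le> B"
  shows "\<bar>(averaging K ^^ k) f i\<bar> \<le> B * \<theta> ^ k"
proof (induction k arbitrary: i)
  case (Suc k)
  have B: "0 \<le> B" using f[of i] by linarith
  have "\<bar>(averaging K ^^ Suc k) f i\<bar> \<le> (\<Sum>j\<in>UNIV. \<bar>K i j * (averaging K ^^ k) f j\<bar>)"
    by (simp add: averaging_def sum_abs)
  also have "\<dots> \<le> (\<Sum>j\<in>UNIV. K i j * (B * \<theta> ^ k))"
    using K Suc by (intro sum_mono) (simp add: abs_mult mult_left_mono)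
  also have "\<dots> = (\<Sum>j\<in>UNIV. K i j) * (B * \<theta> ^ k)" by (simp add: sum_distrib_right)
  also have "\<dots> \<le> \<theta> * (B * \<theta> ^ k)" using K B \<theta> by (intro mult_right_mono) auto
  finally show ?case by (simp add: mult_ac)
qed (use f in simp)

lemma averaging_power_nonneg:
  assumes "\<And>i j. 0 \<le> K i j" "\<And>i. 0 \<le> f i"
  shows "0 \<le> (averaging K ^^ k) f i"
  by (induction k arbitrary: i) (auto simp: averaging_def assms intro!: sum_nonneg)

text \<open>
  Applying the positive operator \<open>K\<close> repeatedly preserves the inequality \<open>a * f \<le> w - K w\<close>. The
  right-hand sides telescope when they are summed over \<open>k\<close>.
\<close>

lemma averaging_power_comparison:
  assumes K: "\<And>i j. 0 \<le> K i j" and ab: "\<And>i. a * f i \<le> w i - averaging K w i"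
  shows "a * (averaging K ^^ k) f i \<le> (averaging K ^^ k) w i - (averaging K ^^ Suc k) w i"
proof (induction k arbitrary: i)
  case (Suc k)
  have "a * (averaging K ^^ Suc k) f i = averaging K (\<lambda>j. a * (averaging K ^^ k) f j) i"
    by (simp add: averaging_def sum_distrib_left mult_ac)
  also have "\<dots> \<le> averaging K (\<lambda>j. (averaging K ^^ k) w j - (averaging K ^^ Suc k) w j) i"
    by (rule averaging_mono[OF K Suc])
  also have "\<dots> = (averaging K ^^ Suc k) w i - (averaging K ^^ Suc (Suc k)) w i"
    by (simp add: averaging_def right_diff_distrib sum_subtractf)
  finally show ?case .
qed (use ab in simp)

lemma substochastic_summable:
  assumes K: "\<And>i j. 0 \<le> K i j" "\<And>i. (\<Sum>j\<in>UNIV. K i j) \<le> \<theta>" and \<theta>: "0 \<le> \<theta>" "\<theta> < 1"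
  shows "summable (\<lambda>k. (averaging K ^^ k) (\<lambda>_. 1) i)"
proof (rule summable_comparison_test)
  show "\<exists>n. \<forall>k\<ge>n. norm ((averaging K ^^ k) (\<lambda>_. 1) i) \<le> \<theta> ^ k"
    using substochastic_power_bound[OF K \<theta>(1), of "\<lambda>_. 1" 1] by simp
qed (use \<theta> in \<open>simp add: summable_geometric\<close>)

text \<open>
  If \<open>w - K w\<close> lies between the constants \<open>a\<close> and \<open>b\<close>, then \<open>w = (1 - K)\<^sup>-\<^sup>1 (w - K w)\<close> lies between the
  corresponding multiples of \<open>(1 - K)\<^sup>-\<^sup>1 1\<close>, where the inverse is the Neumann series, which is positive.
\<close>

lemma substochastic_resolvent:
  assumes K: "\<And>i j. 0 \<le> K i j" "\<And>i. (\<Sum>j\<in>UNIV. K i j) \<le> \<theta>" and \<theta>: "0 \<le> \<theta>" "\<theta> < 1"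
    and lo: "\<And>i. a \<le> w i - averaging K w i" and hi: "\<And>i. w i - averaging K w i \<le> b"
  defines "z \<equiv> \<lambda>k. (averaging K ^^ k) (\<lambda>_. 1)"
  shows "a * (\<Sum>k. z k i) \<le> w i" and "w i \<le> b * (\<Sum>k. z k i)"
proof -
  have sm: "summable (\<lambda>k. z k i)"
    unfolding z_def by (rule substochastic_summable[OF K \<theta>])
  define v where "v k = (averaging K ^^ k) w i" for k
  have v_lim: "v \<longlonglongrightarrow> 0"
  proof -
    define B where "B = Max (range (\<lambda>i. \<bar>w i\<bar>))"
    have B: "\<bar>w i\<bar> \<le> B" for i unfolding B_def by (intro Max_ge) auto
    have "(\<lambda>k. B * \<theta> ^ k) \<longlonglongrightarrow> B * 0"
      by (intro tendsto_mult tendsto_const LIMSEQ_power_zero) (use \<theta> in auto)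
    then have geo: "(\<lambda>k. B * \<theta> ^ k) \<longlonglongrightarrow> 0" by simp
    have "norm (v k) \<le> B * \<theta> ^ k" for k
      unfolding v_def real_norm_def by (rule substochastic_power_bound[OF K \<theta>(1) B])
    then show ?thesis by (intro Lim_null_comparison[OF always_eventually geo] allI)
  qed
  have tel: "(\<lambda>k. v k - v (Suc k)) sums w i"
    using telescope_sums'[OF v_lim] by (simp add: v_def)
  have "a * z k i \<le> v k - v (Suc k)" for k
    using averaging_power_comparison[where K=K and a=a and f="\<lambda>_. 1" and w=w and k=k and i=i, OF K(1)] lo by (simp add: z_def v_def)
  from sums_le[OF this summable_sums[OF summable_mult[OF sm]] tel]
  show "a * (\<Sum>k. z k i) \<le> w i" using suminf_mult[OF sm] by simp
  have hi': "- b * 1 \<le> - w i - averaging K (\<lambda>i. - w i) i" for i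
    using hi[of i] by (simp add: averaging_def sum_negf)
  have neg: "(averaging K ^^ k) (\<lambda>i. - w i) i = - (averaging K ^^ k) w i" for k i
    by (induction k arbitrary: i) (auto simp: averaging_def sum_negf)
  have "v k - v (Suc k) \<le> b * z k i" for k
    using averaging_power_comparison[where K=K and a="- b" and f="\<lambda>_. 1" and w="\<lambda>i. - w i" and k=k and i=i, OF K(1) hi']  neg[of k i] neg[of "Suc k" i]
    unfolding z_def v_def by linarith
  from sums_le[OF this tel summable_sums[OF summable_mult[OF sm]]]
  show "w i \<le> b * (\<Sum>k. z k i)" using suminf_mult[OF sm] by simp
qed

section \<open>The chain observed on a grid\<close>

text \<open>
  The Markov property along the grid, as a product formula. It holds also after a prefix of
  probability 0, where both sides vanish, and hence can be iterated without case distinctions.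
\<close>

lemma ctmc_grid:
  assumes "ctmc M X i0 q" "prob_space M"
  shows "\<exists>p. transition_function p \<and>
    (\<forall>i j. i \<noteq> j \<longrightarrow> ((\<lambda>h. p h i j / h) \<longlongrightarrow> q i j) (at_right 0)) \<and>
    (\<forall>h n s. 0 < h \<longrightarrow> \<P>(\<omega> in M. \<forall>k\<le>Suc n. X (real k * h) \<omega> = s k) =
        \<P>(\<omega> in M. \<forall>k\<le>n. X (real k * h) \<omega> = s k) * p h (s n) (s (Suc n)))"
proof -
  interpret prob_space M by fact
  have meas [measurable]: "X t \<in> measurable M (count_space UNIV)" if "0 \<le> t" for t
    using assms(1) that by (auto simp: ctmc_def)
  obtain p where p: "transition_function p"
    "\<And>i j. i \<noteq> j \<Longrightarrow> ((\<lambda>h. p h i j / h) \<longlongrightarrow> q i j) (at_right 0)"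
    and markov: "\<And>(n::nat) t s j.
           0 \<le> t 0 \<and> (\<forall>k\<le>n. t k < t (Suc k)) \<and>
           0 < \<P>(\<omega> in M. \<forall>k\<le>n. X (t k) \<omega> = s k) \<Longrightarrow>
           \<P>(\<omega> in M. X (t (Suc n)) \<omega> = j \<bar> \<forall>k\<le>n. X (t k) \<omega> = s k)
             = p (t (Suc n) - t n) (s n) j"
    using assms(1) unfolding ctmc_def by blast
  have "\<P>(\<omega> in M. \<forall>k\<le>Suc n. X (real k * h) \<omega> = s k) =
        \<P>(\<omega> in M. \<forall>k\<le>n. X (real k * h) \<omega> = s k) * p h (s n) (s (Suc n))" if h: "0 < h" for h n s
  proof -
    have [measurable]: "X (real k * h) \<in> measurable M (count_space UNIV)" for k
      using h by (intro meas) simp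
    have split: "(\<forall>k\<le>Suc n. X (real k * h) \<omega> = s k) \<longleftrightarrow>
       X (real (Suc n) * h) \<omega> = s (Suc n) \<and> (\<forall>k\<le>n. X (real k * h) \<omega> = s k)" for \<omega>
      by (auto simp: le_Suc_eq)
    show ?thesis
    proof (cases "0 < \<P>(\<omega> in M. \<forall>k\<le>n. X (real k * h) \<omega> = s k)")
      case True
      have "\<P>(\<omega> in M. X (real (Suc n) * h) \<omega> = s (Suc n) \<bar> \<forall>k\<le>n. X (real k * h) \<omega> = s k)
         = p h (s n) (s (Suc n))"
        using markov[of "\<lambda>k. real k * h" n s "s (Suc n)"] True h by (simp add: algebra_simps)
      then show ?thesis using True unfolding split cond_prob_def by (simp add: field_simps)
    next
      case False
      then have z: "\<P>(\<omega> in M. \<forall>k\<le>n. X (real k * h) \<omega> = s k) = 0"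
        using measure_nonneg[of M "{\<omega> \<in> space M. \<forall>k\<le>n. X (real k * h) \<omega> = s k}"] by linarith
      have "\<P>(\<omega> in M. \<forall>k\<le>Suc n. X (real k * h) \<omega> = s k) \<le> \<P>(\<omega> in M. \<forall>k\<le>n. X (real k * h) \<omega> = s k)"
        by (intro finite_measure_mono) auto
      then show ?thesis using z measure_nonneg[of M "{\<omega> \<in> space M. \<forall>k\<le>Suc n. X (real k * h) \<omega> = s k}"] by simp
    qed
  qed
  with p show ?thesis by blast
qed

text \<open>
  A discrete Feynman-Kac formula: a chain with step matrix \<open>P\<close> whose steps into \<open>j\<close> are weighted by
  \<open>d j\<close> is governed by the powers of \<open>P i j * d j\<close>. The induction peels off the first of the \<open>l\<close>
  steps, since the Markov property conditions on an initial segment of the path; this is why the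
  statement carries an arbitrary prefix \<open>s\<close>.
\<close>

lemma grid_expectation:
  fixes Y :: "nat \<Rightarrow> 'a \<Rightarrow> 's::finite" and d :: "'s \<Rightarrow> real"
  assumes "prob_space M" and meas: "\<And>k. Y k \<in> measurable M (count_space UNIV)"
    and step: "\<And>n s. \<P>(\<omega> in M. \<forall>k\<le>Suc n. Y k \<omega> = s k) =
        \<P>(\<omega> in M. \<forall>k\<le>n. Y k \<omega> = s k) * P (s n) (s (Suc n))"
  shows "(\<integral>\<omega>. indicator {\<omega> \<in> space M. \<forall>k\<le>n. Y k \<omega> = s k} \<omega> * (\<Prod>k=n..<n+l. d (Y (Suc k) \<omega>)) \<partial>M)
    = \<P>(\<omega> in M. \<forall>k\<le>n. Y k \<omega> = s k) * (averaging (\<lambda>i j. P i j * d j) ^^ l) (\<lambda>_. 1) (s n)"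
proof (induction l arbitrary: n s)
  case 0
  interpret prob_space M by fact
  note meas [measurable]
  show ?case by simp
next
  case (Suc l)
  interpret prob_space M by fact
  note meas [measurable]
  define I where "I n s = (indicator {\<omega> \<in> space M. \<forall>k\<le>n. Y k \<omega> = s k} :: 'a \<Rightarrow> real)" for n s
  define D where "D n \<omega> = (\<Prod>k=n..<n+l. d (Y (Suc k) \<omega>))" for n \<omega>
  have IH: "(\<integral>\<omega>. I n s \<omega> * D n \<omega> \<partial>M) =
     \<P>(\<omega> in M. \<forall>k\<le>n. Y k \<omega> = s k) * (averaging (\<lambda>i j. P i j * d j) ^^ l) (\<lambda>_. 1) (s n)" for n s
    using Suc unfolding I_def D_def .
  have dm [measurable]: "(\<lambda>\<omega>. d (Y k \<omega>)) \<in> borel_measurable M" for k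
    by (rule measurable_compose[OF meas]) simp
  define b where "b = Max (range (\<lambda>i. \<bar>d i\<bar>))"
  have b: "\<bar>d i\<bar> \<le> b" for i unfolding b_def by (intro Max_ge) auto
  have int: "integrable M (\<lambda>\<omega>. I n s \<omega> * D n \<omega>)" for n s
  proof (rule integrable_const_bound[where B="b ^ l"])
    have "\<bar>D n \<omega>\<bar> \<le> b ^ l" for \<omega>
    proof -
      have "\<bar>D n \<omega>\<bar> \<le> (\<Prod>k=n..<n+l. b)" unfolding D_def abs_prod by (intro prod_mono) (auto simp: b)
      then show ?thesis by simp
    qed
    moreover have "0 \<le> b ^ l" using b[of undefined] by (intro zero_le_power) linarith
    ultimately show "AE \<omega> in M. norm (I n s \<omega> * D n \<omega>) \<le> b ^ l"
      by (auto simp: I_def indicator_def)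
    show "(\<lambda>\<omega>. I n s \<omega> * D n \<omega>) \<in> borel_measurable M" unfolding I_def D_def by measurable
  qed
  have "I n s \<omega> * (\<Prod>k=n..<n+Suc l. d (Y (Suc k) \<omega>))
      = (\<Sum>j\<in>UNIV. d j * (I (Suc n) (s(Suc n := j)) \<omega> * D (Suc n) \<omega>))" if "\<omega> \<in> space M" for \<omega>
  proof -
    have "I (Suc n) (s(Suc n := j)) \<omega> = (if Y (Suc n) \<omega> = j then I n s \<omega> else 0)" for j
      using that by (auto simp: I_def indicator_def le_Suc_eq)
    then have "(\<Sum>j\<in>UNIV. d j * (I (Suc n) (s(Suc n := j)) \<omega> * D (Suc n) \<omega>)) =
       (\<Sum>j\<in>UNIV. if Y (Suc n) \<omega> = j then d j * (I n s \<omega> * D (Suc n) \<omega>) else 0)"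
      by (intro sum.cong) auto
    also have "\<dots> = d (Y (Suc n) \<omega>) * (I n s \<omega> * D (Suc n) \<omega>)" by simp
    also have "\<dots> = I n s \<omega> * (\<Prod>k=n..<n+Suc l. d (Y (Suc k) \<omega>))"
      unfolding D_def by (subst prod.atLeast_Suc_lessThan) (auto simp: algebra_simps)
    finally show ?thesis by simp
  qed
  then have "(\<integral>\<omega>. I n s \<omega> * (\<Prod>k=n..<n+Suc l. d (Y (Suc k) \<omega>)) \<partial>M) =
    (\<integral>\<omega>. (\<Sum>j\<in>UNIV. d j * (I (Suc n) (s(Suc n := j)) \<omega> * D (Suc n) \<omega>)) \<partial>M)"
    by (intro Bochner_Integration.integral_cong) auto
  also have "\<dots> = (\<Sum>j\<in>UNIV. d j * (\<integral>\<omega>. I (Suc n) (s(Suc n := j)) \<omega> * D (Suc n) \<omega> \<partial>M))"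
    using int by (subst Bochner_Integration.integral_sum) (auto intro!: integrable_mult_right)
  also have "\<dots> = (\<Sum>j\<in>UNIV. d j * (\<P>(\<omega> in M. \<forall>k\<le>n. Y k \<omega> = s k) * P (s n) j *
      (averaging (\<lambda>i j. P i j * d j) ^^ l) (\<lambda>_. 1) j))"
  proof (intro sum.cong refl)
    fix j
    have "\<P>(\<omega> in M. \<forall>k\<le>n. Y k \<omega> = (s(Suc n := j)) k) = \<P>(\<omega> in M. \<forall>k\<le>n. Y k \<omega> = s k)"
      by (intro arg_cong[where f=prob]) auto
    then show "d j * (\<integral>\<omega>. I (Suc n) (s(Suc n := j)) \<omega> * D (Suc n) \<omega> \<partial>M) =
       d j * (\<P>(\<omega> in M. \<forall>k\<le>n. Y k \<omega> = s k) * P (s n) j *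
      (averaging (\<lambda>i j. P i j * d j) ^^ l) (\<lambda>_. 1) j)"
      unfolding IH step by simp
  qed
  also have "\<dots> = \<P>(\<omega> in M. \<forall>k\<le>n. Y k \<omega> = s k) * (averaging (\<lambda>i j. P i j * d j) ^^ Suc l) (\<lambda>_. 1) (s n)"
    by (simp add: averaging_def sum_distrib_left mult_ac)
  finally show ?case unfolding I_def .
qed

section \<open>The law of the first visit\<close>

text \<open>
  The layer-cake formula: write \<open>f x\<close> as the length of \<open>{t. 0 \<le> t \<and> t < f x}\<close> and exchange the order of
  integration.
\<close>

lemma nn_integral_tail:
  assumes "sigma_finite_measure M" and f: "f \<in> borel_measurable M"
  shows "(\<integral>\<^sup>+x. f x \<partial>M) = (\<integral>\<^sup>+t. emeasure M {x \<in> space M. ennreal t < f x} * indicator {0..} t \<partial>lborel)"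
proof -
  interpret sigma_finite_measure M by fact
  interpret pair_sigma_finite M lborel ..
  note f [measurable]
  define F where "F x t = (indicator {t. 0 \<le> t \<and> ennreal t < f x} t :: ennreal)" for x t
  have F_meas: "case_prod F \<in> borel_measurable (M \<Otimes>\<^sub>M lborel)"
    unfolding F_def indicator_def by measurable
  have "f x = (\<integral>\<^sup>+t. F x t \<partial>lborel)" for x
  proof -
    have "{t. 0 \<le> t \<and> ennreal t < f x} \<in> sets lborel" by measurable
    then have "(\<integral>\<^sup>+t. F x t \<partial>lborel) = emeasure lborel {t. 0 \<le> t \<and> ennreal t < f x}"
      unfolding F_def by simp
    also have "\<dots> = f x"
    proof (cases "f x")
      case (real r)
      then have "{t. 0 \<le> t \<and> ennreal t < f x} = {0..<r}" by (auto simp: ennreal_less_iff)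
      then show ?thesis using real by simp
    next
      case top
      then have "{t. 0 \<le> t \<and> ennreal t < f x} = {0..}" by (auto simp: less_top)
      moreover have "emeasure lborel {0::real..} = \<top>"
      proof (rule top.extremum_uniqueI)
        have "of_nat n \<le> emeasure lborel {0::real..}" for n
          using emeasure_mono[of "{0..real n}" "{0::real..}" lborel] by (simp add: ennreal_of_nat_eq_real_of_nat)
        then show "\<top> \<le> emeasure lborel {0::real..}"
          unfolding ennreal_SUP_of_nat_eq_top[symmetric] by (intro SUP_least)
      qed
      ultimately show ?thesis using top by simp
    qed
    finally show ?thesis ..
  qed
  then have "(\<integral>\<^sup>+x. f x \<partial>M) = (\<integral>\<^sup>+x. \<integral>\<^sup>+t. F x t \<partial>lborel \<partial>M)" by simp
  also have "\<dots> = (\<integral>\<^sup>+t. \<integral>\<^sup>+x. F x t \<partial>M \<partial>lborel)"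
    using Fubini'[OF F_meas] by simp
  also have "\<dots> = (\<integral>\<^sup>+t. emeasure M {x \<in> space M. ennreal t < f x} * indicator {0..} t \<partial>lborel)"
  proof (intro nn_integral_cong)
    fix t :: real
    have "(\<integral>\<^sup>+x. F x t \<partial>M) = (\<integral>\<^sup>+x. indicator {0..} t * indicator {x \<in> space M. ennreal t < f x} x \<partial>M)"
      by (intro nn_integral_cong) (auto simp: F_def indicator_def)
    also have "\<dots> = indicator {0..} t * emeasure M {x \<in> space M. ennreal t < f x}"
      by (intro nn_integral_cmult_indicator) measurable
    finally show "(\<integral>\<^sup>+x. F x t \<partial>M) = emeasure M {x \<in> space M. ennreal t < f x} * indicator {0..} t"
      by (simp add: mult.commute)
  qed
  finally show ?thesis .
qed

text \<open>
  Right-continuity of the counting path makes the inequality strict: a path without points up to time \<open>t\<close>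
  stays without points for a while longer.
\<close>

lemma less_first_visit_iff:
  assumes "modulated_poisson M X m N" "\<omega> \<in> space M" "0 \<le> t"
  shows "ennreal t < first_visit N \<omega> \<longleftrightarrow> N t \<omega> = 0"
proof -
  have N0: "N 0 \<omega> = 0" and mono: "\<And>u v. 0 \<le> u \<Longrightarrow> u \<le> v \<Longrightarrow> N u \<omega> \<le> N v \<omega>"
    and rc: "\<forall>\<^sub>F u in at_right t. N u \<omega> = N t \<omega>"
    using assms unfolding modulated_poisson_def by (auto simp: mono_on_def)
  show ?thesis
  proof
    assume less: "ennreal t < first_visit N \<omega>"
    show "N t \<omega> = 0"
    proof (rule ccontr)
      assume N: "N t \<omega> \<noteq> 0"
      then have "0 < t" using N0 assms(3) by (cases "t = 0") auto
      then have "first_visit N \<omega> \<le> ennreal t"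
        unfolding first_visit_def using N by (intro INF_lower) auto
      with less show False by simp
    qed
  next
    assume N: "N t \<omega> = 0"
    obtain b where b: "t < b" "\<And>u. t < u \<Longrightarrow> u < b \<Longrightarrow> N u \<omega> = N t \<omega>"
      using rc unfolding eventually_at_right_field by blast
    have "b \<le> u" if "0 < u" "1 \<le> N u \<omega>" for u
    proof (rule ccontr)
      assume "\<not> b \<le> u"
      then have "N u \<omega> = 0"
        using b(2)[of u] mono[of u t] that(1) N by (cases "t < u") auto
      with that show False by simp
    qed
    then have "ennreal b \<le> first_visit N \<omega>"
      unfolding first_visit_def by (intro INF_greatest) (auto intro!: ennreal_leI)
    moreover have "ennreal t < ennreal b" using b(1) assms(3) by (simp add: ennreal_lessI)
    ultimately show "ennreal t < first_visit N \<omega>" by (rule order_less_le_trans[rotated])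
  qed
qed

lemma first_visit_measurable:
  assumes "modulated_poisson M X m N"
  shows "first_visit N \<in> borel_measurable M"
proof (rule borel_measurableI_greater)
  fix y :: ennreal
  have [measurable]: "N t \<in> measurable M (count_space UNIV)" if "0 \<le> t" for t
    using assms that by (auto simp: modulated_poisson_def)
  show "{\<omega> \<in> space M. y < first_visit N \<omega>} \<in> sets M"
  proof (cases y)
    case (real r)
    then have "{\<omega> \<in> space M. y < first_visit N \<omega>} = {\<omega> \<in> space M. N r \<omega> = 0}"
      using less_first_visit_iff[OF assms] by auto
    then show ?thesis using real by simp
  qed simp
qed

lemma subalgebra_path_algebra:
  assumes "\<And>t. 0 \<le> t \<Longrightarrow> X t \<in> measurable M (count_space UNIV)"
  shows "subalgebra M (path_algebra M X)"
proof -
  have gen: "{X t -` A \<inter> space M | t A. 0 \<le> t} \<subseteq> sets M"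
    using measurable_sets[OF assms] by auto
  then have "{X t -` A \<inter> space M | t A. 0 \<le> t} \<subseteq> Pow (space M)" by auto
  then show ?thesis
    using sets.sigma_sets_subset[OF gen]
    by (simp add: subalgebra_def path_algebra_def space_measure_of_conv)
qed

text \<open>
  Integrating the conditional probability of seeing no point in \<open>(0, t]\<close> given the environment path.
\<close>

lemma void_probability:
  assumes "prob_space M" and X: "\<And>t. 0 \<le> t \<Longrightarrow> X t \<in> measurable M (count_space UNIV)"
    and poisson: "modulated_poisson M X m N" and t: "0 \<le> t"
    and meas: "(\<lambda>\<omega>. LBINT u:{0..t}. m (X u \<omega>)) \<in> borel_measurable M"
  shows "\<P>(\<omega> in M. N t \<omega> = 0) = (\<integral>\<omega>. exp (- (LBINT u:{0..t}. m (X u \<omega>))) \<partial>M)"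
proof -
  interpret prob_space M by fact
  interpret finite_measure_subalgebra M "path_algebra M X"
    by unfold_locales (rule subalgebra_path_algebra[OF X])
  note meas [measurable]
  have [measurable]: "N t \<in> measurable M (count_space UNIV)" using poisson t by (auto simp: modulated_poisson_def)
  have N0: "N 0 \<omega> = 0" if "\<omega> \<in> space M" for \<omega> using poisson that by (auto simp: modulated_poisson_def)
  define E where "E = {\<omega> \<in> space M. N t \<omega> = 0}"
  have E [measurable]: "E \<in> sets M" unfolding E_def by measurable
  \<comment> \<open>The two-point partition of \<open>[0, t]\<close>, with no point required in its only interval.\<close>
  define \<tau> where "\<tau> i = (if i = (0::nat) then 0 else t)" for i
  have "0 \<le> \<tau> 0 \<and> (\<forall>i<1. \<tau> i \<le> \<tau> (Suc i))" using t by (simp add: \<tau>_def)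
  then have "AE \<omega> in M. real_cond_exp M (path_algebra M X)
             (indicator {\<omega> \<in> space M. \<forall>i<1. N (\<tau> (Suc i)) \<omega> = N (\<tau> i) \<omega> + (\<lambda>_. 0) i}) \<omega>
           = (\<Prod>i<1. let \<Lambda> = (LBINT u:{\<tau> i..\<tau> (Suc i)}. m (X u \<omega>))
                     in \<Lambda> ^ ((\<lambda>_. 0) i) / fact ((\<lambda>_. 0) i) * exp (- \<Lambda>))"
    by (rule poisson[unfolded modulated_poisson_def, THEN conjunct2, THEN conjunct2,
      THEN spec[of _ 1], THEN spec[of _ \<tau>], THEN spec[of _ "\<lambda>_. 0"], THEN mp])
  moreover have "{\<omega> \<in> space M. \<forall>i<1. N (\<tau> (Suc i)) \<omega> = N (\<tau> i) \<omega> + (\<lambda>_. 0) i} = E"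
    using N0 by (auto simp: E_def \<tau>_def)
  ultimately have ae: "AE \<omega> in M. real_cond_exp M (path_algebra M X) (indicator E) \<omega>
      = exp (- (LBINT u:{0..t}. m (X u \<omega>)))"
    by (simp add: \<tau>_def Let_def)
  have "integrable M (indicator E :: 'a \<Rightarrow> real)" by (simp add: emeasure_eq_measure)
  from real_cond_exp_int(2)[OF this]
  have "prob E = (\<integral>\<omega>. real_cond_exp M (path_algebra M X) (indicator E) \<omega> \<partial>M)" by simp
  also have "\<dots> = (\<integral>\<omega>. exp (- (LBINT u:{0..t}. m (X u \<omega>))) \<partial>M)"
    by (rule integral_cong_AE) (use ae in auto)
  finally show ?thesis by (simp add: E_def)
qed

section \<open>Killing at the visit rate\<close>

text \<open>
  The matrices \<open>p h i j * exp (- (h * m j))\<close> are the one-step transition matrices of the chain killed at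
  rate \<open>m\<close>, up to an error that is negligible as \<open>h\<close> tends to 0. Their derivative at \<open>h = 0\<close> is the
  generator \<open>Q - m\<close>, and the limit is the negative of that generator applied to \<open>w\<close>.
\<close>

lemma killed_generator:
  fixes p :: "real \<Rightarrow> 's::finite \<Rightarrow> 's \<Rightarrow> real"
  assumes p: "transition_function p"
    and rates: "\<And>i j. i \<noteq> j \<Longrightarrow> ((\<lambda>h. p h i j / h) \<longlongrightarrow> q i j) (at_right 0)"
  shows "((\<lambda>h. (w i - averaging (\<lambda>i j. p h i j * exp (- (h * m j))) w i) / h)
     \<longlongrightarrow> m i * w i - (\<Sum>j\<in>-{i}. q i j * (w j - w i))) (at_right 0)"
proof -
  have e0: "((\<lambda>h. exp (- (h * m j))) \<longlongrightarrow> 1) (at_right 0)" for j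
    by (rule tendsto_eq_intros refl | simp)+
  have "((\<lambda>h. 1 - exp (- (h * m i))) has_field_derivative m i) (at 0)"
    by (auto intro!: derivative_eq_intros)
  then have e1: "((\<lambda>h. (1 - exp (- (h * m i))) / h) \<longlongrightarrow> m i) (at_right 0)"
    unfolding has_field_derivative_iff by (simp add: filterlim_at_split)
  have lim: "((\<lambda>h. w i * ((1 - exp (- (h * m i))) / h) -
      (\<Sum>j\<in>-{i}. p h i j / h * (exp (- (h * m j)) * w j - exp (- (h * m i)) * w i)))
      \<longlongrightarrow> w i * m i - (\<Sum>j\<in>-{i}. q i j * (1 * w j - 1 * w i))) (at_right 0)"
    by (intro tendsto_intros e0 e1 rates) auto
  have "(w i - averaging (\<lambda>i j. p h i j * exp (- (h * m j))) w i) / h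
    = w i * ((1 - exp (- (h * m i))) / h) -
      (\<Sum>j\<in>-{i}. p h i j / h * (exp (- (h * m j)) * w j - exp (- (h * m i)) * w i))" if h: "0 < h" for h
  proof -
    have split: "(\<Sum>j\<in>UNIV. f j) = f i + (\<Sum>j\<in>-{i}. f j)" for f :: "'s \<Rightarrow> real"
      by (subst sum.remove[of _ i]) (auto simp: Compl_eq_Diff_UNIV)
    have "(\<Sum>j\<in>UNIV. p h i j) = 1" using p h by (simp add: transition_function_def)
    \<comment> \<open>The rows sum to 1, so the diagonal entry, on which the rates are silent, can be eliminated.\<close>
    then have pii: "p h i i = 1 - (\<Sum>j\<in>-{i}. p h i j)" using split[of "p h i"] by simp
    have "averaging (\<lambda>i j. p h i j * exp (- (h * m j))) w i =
       exp (- (h * m i)) * w i + (\<Sum>j\<in>-{i}. p h i j * (exp (- (h * m j)) * w j - exp (- (h * m i)) * w i))"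
      unfolding averaging_def split pii
      by (simp add: right_diff_distrib left_diff_distrib sum_subtractf sum_distrib_right mult.assoc)
    moreover have "(\<Sum>j\<in>-{i}. p h i j / h * (exp (- (h * m j)) * w j - exp (- (h * m i)) * w i)) =
       (\<Sum>j\<in>-{i}. p h i j * (exp (- (h * m j)) * w j - exp (- (h * m i)) * w i)) / h"
      by (simp add: sum_divide_distrib)
    ultimately show ?thesis by (simp add: diff_divide_distrib add_divide_distrib algebra_simps)
  qed
  then have "\<forall>\<^sub>F h in at_right 0. w i * ((1 - exp (- (h * m i))) / h) -
      (\<Sum>j\<in>-{i}. p h i j / h * (exp (- (h * m j)) * w j - exp (- (h * m i)) * w i)) =
     (w i - averaging (\<lambda>i j. p h i j * exp (- (h * m j))) w i) / h"
    by (auto simp: eventually_at_right_less intro: eventually_mono[OF eventually_at_right_less])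
  from Lim_transform_eventually[OF lim this] show ?thesis by (simp add: mult.commute)
qed

text \<open>
  The integral of a function that is constant on the cells; it turns the integral over time of a survival
  probability of the discretized chain into a sum over its steps.
\<close>

lemma nn_integral_cells:
  assumes h: "0 < h" and z: "\<And>k. 0 \<le> z k" "summable z"
  shows "(\<integral>\<^sup>+t. ennreal (z (cell h t) * indicator {0<..} t) \<partial>lborel) = ennreal (h * (\<Sum>k. z k))"
proof -
  have "ennreal (z (cell h t) * indicator {0<..} t) =
     (\<Sum>k. ennreal (z k) * indicator {real k * h<..real (Suc k) * h} t)" for t
  proof (cases "0 < t")
    case True
    have "(\<lambda>k. ennreal (z k) * indicator {real k * h<..real (Suc k) * h} t) =
       (\<lambda>k. if k = cell h t then ennreal (z k) else 0)"
      by (simp add: indicator_cell[OF h True] fun_eq_iff del: of_nat_Suc)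
    then show ?thesis using True
      by (simp add: sums_unique[OF sums_single, symmetric])
  next
    case False
    have "indicator {real k * h<..real (Suc k) * h} t = (0::ennreal)" for k
    proof -
      have "0 \<le> real k * h" using h by simp
      then have "\<not> real k * h < t" using False by linarith
      then show ?thesis by (simp add: indicator_def)
    qed
    then show ?thesis using False by simp
  qed
  then have "(\<integral>\<^sup>+t. ennreal (z (cell h t) * indicator {0<..} t) \<partial>lborel) =
    (\<Sum>k. \<integral>\<^sup>+t. ennreal (z k) * indicator {real k * h<..real (Suc k) * h} t \<partial>lborel)"
    by (simp add: nn_integral_suminf)
  also have "\<dots> = (\<Sum>k. ennreal (z k * h))"
    using h z by (intro suminf_cong)
      (simp add: nn_integral_cmult_indicator mult_right_mono ennreal_mult' left_diff_distrib[symmetric])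
  also have "\<dots> = ennreal (\<Sum>k. z k * h)"
    using z h by (intro suminf_ennreal2) (auto intro: summable_mult2)
  finally show ?thesis using suminf_mult2[OF z(2), of h] by (simp add: mult.commute)
qed

text \<open>
  The probability that no visit happens up to time \<open>t\<close> is the mean of \<open>exp (- A)\<close>, where \<open>A\<close> is the integral
  of the intensity along the path. Replacing \<open>A\<close> by its Riemann sums gives a mean that the chain on the
  grid determines, and dominated convergence lets the mesh tend to 0.
\<close>

lemma survival_limit:
  fixes X :: "real \<Rightarrow> 'a \<Rightarrow> 's::finite"
  assumes "prob_space M" and X: "ctmc M X i0 q" and poisson: "modulated_poisson M X m N"
    and m: "\<And>i. 0 \<le> m i"
    and step: "\<And>h n s. 0 < h \<Longrightarrow> \<P>(\<omega> in M. \<forall>k\<le>Suc n. X (real k * h) \<omega> = s k) =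
        \<P>(\<omega> in M. \<forall>k\<le>n. X (real k * h) \<omega> = s k) * p h (s n) (s (Suc n))"
    and h: "\<And>n. 0 < h n" "h \<longlonglongrightarrow> 0" and t: "0 < t"
  shows "(\<lambda>n. (averaging (\<lambda>i j. p (h n) i j * exp (- (h n * m j))) ^^ cell (h n) t) (\<lambda>_. 1) i0)
           \<longlonglongrightarrow> \<P>(\<omega> in M. N t \<omega> = 0)"
proof -
  interpret prob_space M by fact
  have X_meas: "\<And>t. 0 \<le> t \<Longrightarrow> X t \<in> measurable M (count_space UNIV)"
    and X_rc: "\<And>\<omega> t. \<omega> \<in> space M \<Longrightarrow> 0 \<le> t \<Longrightarrow> \<forall>\<^sub>F u in at_right t. X u \<omega> = X t \<omega>"
    and X_0: "AE \<omega> in M. X 0 \<omega> = i0"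
    using X unfolding ctmc_def by blast+
  have grid_meas: "X (real k * h n) \<in> measurable M (count_space UNIV)" for k n
    using h(1)[of n] by (intro X_meas) simp
  have mX_meas [measurable]: "(\<lambda>\<omega>. m (X (real k * h n) \<omega>)) \<in> borel_measurable M" for k n
    by (rule measurable_compose[OF grid_meas]) simp
  define \<Lambda> where "\<Lambda> \<omega> = (LBINT u:{0..t}. m (X u \<omega>))" for \<omega>
  define A where "A n \<omega> = h n * (\<Sum>k<cell (h n) t. m (X (real (Suc k) * h n) \<omega>))" for n \<omega>
  have A_meas [measurable]: "A n \<in> borel_measurable M" for n
    unfolding A_def by (intro borel_measurable_times borel_measurable_const borel_measurable_sum mX_meas)
  have m_bound: "\<bar>m i\<bar> \<le> Max (range m)" for i using m[of i] by simp
  have A_lim: "(\<lambda>n. A n \<omega>) \<longlonglongrightarrow> \<Lambda> \<omega>" if "\<omega> \<in> space M" for \<omega>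
    unfolding A_def \<Lambda>_def
    by (rule path_integral_limit[where x="\<lambda>u. X u \<omega>", OF X_rc[OF that] m_bound h t])
  have \<Lambda>_meas [measurable]: "\<Lambda> \<in> borel_measurable M"
    by (rule borel_measurable_LIMSEQ_real[OF A_lim A_meas])
  have A_nonneg: "0 \<le> A n \<omega>" for n \<omega>
    unfolding A_def using h(1)[of n] m by (intro mult_nonneg_nonneg sum_nonneg) auto
  have "(\<lambda>n. \<integral>\<omega>. exp (- A n \<omega>) \<partial>M) \<longlonglongrightarrow> (\<integral>\<omega>. exp (- \<Lambda> \<omega>) \<partial>M)"
    by (rule integral_dominated_convergence[where w="\<lambda>_. 1"])
       (use A_lim A_nonneg in \<open>auto intro!: tendsto_intros AE_I2\<close>)
  moreover have "(\<integral>\<omega>. exp (- \<Lambda> \<omega>) \<partial>M) = \<P>(\<omega> in M. N t \<omega> = 0)"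
    unfolding \<Lambda>_def
    by (rule void_probability[symmetric, OF \<open>prob_space M\<close> X_meas poisson])
       (use t \<Lambda>_meas in \<open>auto simp: \<Lambda>_def[abs_def]\<close>)
  moreover have "(\<integral>\<omega>. exp (- A n \<omega>) \<partial>M) =
     (averaging (\<lambda>i j. p (h n) i j * exp (- (h n * m j))) ^^ cell (h n) t) (\<lambda>_. 1) i0" for n
  proof -
    define D where "D \<omega> = (\<Prod>k=0..<0 + cell (h n) t. exp (- (h n * m (X (real (Suc k) * h n) \<omega>))))" for \<omega>
    have D: "D \<omega> = exp (- A n \<omega>)" for \<omega>
      by (simp add: D_def A_def exp_sum[symmetric] sum_negf sum_distrib_left atLeast0LessThan del: of_nat_Suc)
    have start: "AE \<omega> in M. \<forall>k\<le>0. X (real k * h n) \<omega> = i0"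
      using X_0 by simp
    have "(\<integral>\<omega>. exp (- A n \<omega>) \<partial>M) =
      (\<integral>\<omega>. indicator {\<omega> \<in> space M. \<forall>k\<le>0. X (real k * h n) \<omega> = i0} \<omega> * D \<omega> \<partial>M)"
    proof (rule integral_cong_AE)
      show "AE \<omega> in M. exp (- A n \<omega>) =
        indicator {\<omega> \<in> space M. \<forall>k\<le>0. X (real k * h n) \<omega> = i0} \<omega> * D \<omega>"
        using start AE_space by eventually_elim (auto simp: D)
      have [measurable]: "X 0 \<in> measurable M (count_space UNIV)" by (rule X_meas) simp
      show "(\<lambda>\<omega>. indicator {\<omega> \<in> space M. \<forall>k\<le>0. X (real k * h n) \<omega> = i0} \<omega> * D \<omega>) \<in> borel_measurable M"
        unfolding D by simp
    qed measurable
    also have "\<dots> = \<P>(\<omega> in M. \<forall>k\<le>0. X (real k * h n) \<omega> = i0) *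
      (averaging (\<lambda>i j. p (h n) i j * exp (- (h n * m j))) ^^ cell (h n) t) (\<lambda>_. 1) i0"
      unfolding D_def
      by (rule grid_expectation[where Y="\<lambda>k. X (real k * h n)" and n=0 and s="\<lambda>_. i0"
            and d="\<lambda>i. exp (- (h n * m i))", OF \<open>prob_space M\<close> grid_meas step[OF h(1)]])
    also have "\<P>(\<omega> in M. \<forall>k\<le>0. X (real k * h n) \<omega> = i0) = 1"
    proof -
      have [measurable]: "X 0 \<in> measurable M (count_space UNIV)" by (rule X_meas) simp
      show ?thesis using X_0 by (intro prob_Collect_eq_1[THEN iffD2]) auto
    qed
    finally show ?thesis by simp
  qed
  ultimately show ?thesis by simp
qed

text \<open>
  The hypothesis on \<open>w\<close> is the system of first-step equations \<open>(m - Q) w = 1\<close> for the mean time until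
  the first visit. Let \<open>K\<close> be the killed one-step matrix with mesh \<open>h\<close>. By the lemma \<open>killed_generator\<close>,
  \<open>w - K w\<close> is \<open>h\<close> up to a relative error that tends to 0, so by the lemma \<open>substochastic_resolvent\<close> the
  discretized mean time \<open>h * (\<Sum>k. (K ^^ k) 1)\<close> converges to \<open>w\<close>. On the other hand it is the integral over
  \<open>t\<close> of the discretized survival probability, and so converges to the mean of the first visit.
\<close>

lemma mean_sojourn_first_step:
  fixes X :: "real \<Rightarrow> 'a \<Rightarrow> 's::finite"
  assumes "prob_space M" and X: "ctmc M X i0 q" and poisson: "modulated_poisson M X m N"
    and m: "\<And>i. 0 < m i"
    and w: "\<And>i. m i * w i - (\<Sum>j\<in>-{i}. q i j * (w j - w i)) = 1"
  shows "mean_sojourn M N = w i0"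
proof -
  interpret prob_space M by fact
  obtain p where p: "transition_function p"
    and rates: "\<And>i j. i \<noteq> j \<Longrightarrow> ((\<lambda>h. p h i j / h) \<longlongrightarrow> q i j) (at_right 0)"
    and step: "\<And>h n s. 0 < h \<Longrightarrow> \<P>(\<omega> in M. \<forall>k\<le>Suc n. X (real k * h) \<omega> = s k) =
        \<P>(\<omega> in M. \<forall>k\<le>n. X (real k * h) \<omega> = s k) * p h (s n) (s (Suc n))"
    using ctmc_grid[OF X \<open>prob_space M\<close>] by blast
  define h where "h n = inverse (real (Suc n))" for n
  have h: "0 < h n" "h n \<le> 1" for n by (auto simp: h_def inverse_le_1_iff)
  have h_lim: "h \<longlonglongrightarrow> 0" unfolding h_def by (rule LIMSEQ_inverse_real_of_nat)
  have h_right: "filterlim h (at_right 0) sequentially"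
    using h_lim h(1) by (auto simp: filterlim_at less_imp_neq[OF h(1), symmetric])
  define K where "K n i j = p (h n) i j * exp (- (h n * m j))" for n i j
  define z where "z n k = (averaging (K n) ^^ k) (\<lambda>_. 1) i0" for n k
  define G where "G t = \<P>(\<omega> in M. N t \<omega> = 0)" for t
  define c where "c = Min (range m)"
  have c: "0 < c" "c \<le> m i" for i using m by (auto simp: c_def)
  have K_nonneg: "0 \<le> K n i j" for n i j
    using p h(1)[of n] by (simp add: K_def transition_function_def)
  have K_row: "(\<Sum>j\<in>UNIV. K n i j) \<le> exp (- (h n * c))" for n i
  proof -
    have "(\<Sum>j\<in>UNIV. K n i j) \<le> (\<Sum>j\<in>UNIV. p (h n) i j * exp (- (h n * c)))"
      unfolding K_def using p h(1)[of n] c(2)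
      by (intro sum_mono mult_left_mono) (auto simp: transition_function_def)
    also have "\<dots> = exp (- (h n * c))"
      using p h(1)[of n] by (simp add: sum_distrib_right[symmetric] transition_function_def)
    finally show ?thesis .
  qed
  have \<theta>: "0 \<le> exp (- (h n * c))" "exp (- (h n * c)) < 1" for n
    using h(1)[of n] c(1) by auto
  have z_nonneg: "0 \<le> z n k" for n k
    unfolding z_def by (rule averaging_power_nonneg) (auto simp: K_nonneg)
  have z_bound: "z n k \<le> exp (- (h n * c)) ^ k" for n k
    using substochastic_power_bound[where K="K n" and f="\<lambda>_. 1" and B=1 and k=k and i=i0, OF K_nonneg K_row \<theta>(1)]
    by (simp add: z_def)
  have z_summable: "summable (z n)" for n
    unfolding z_def
    by (rule substochastic_summable[where K="K n" for n, OF K_nonneg K_row \<theta>])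

  \<comment> \<open>The discretized mean time until the first visit converges to the solution of the first-step
    equations.\<close>
  define S where "S n = h n * (\<Sum>k. z n k)" for n
  have S_lim: "S \<longlonglongrightarrow> w i0"
  proof -
    define r where "r n i = (w i - averaging (K n) w i) / h n" for n i
    have r_lim: "(\<lambda>n. r n i) \<longlonglongrightarrow> 1" for i
      using filterlim_compose[OF killed_generator[OF p rates, where w=w and m=m and i=i] h_right]
      by (simp add: r_def K_def[abs_def] w)
    \<comment> \<open>One bound for the relative errors in all states, as the comparison of \<open>w - K w\<close> with
      constants has to be uniform.\<close>
    define \<delta> where "\<delta> n = (\<Sum>i\<in>UNIV. \<bar>r n i - 1\<bar>)" for n
    have "\<delta> \<longlonglongrightarrow> (\<Sum>i\<in>(UNIV::'s set). \<bar>1 - 1\<bar>)"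
      unfolding \<delta>_def by (intro tendsto_intros r_lim)
    then have \<delta>_lim: "\<delta> \<longlonglongrightarrow> 0" by simp
    have \<delta>: "\<bar>r n i - 1\<bar> \<le> \<delta> n" for n i
      unfolding \<delta>_def by (rule member_le_sum) auto
    have \<delta>_nonneg: "0 \<le> \<delta> n" for n unfolding \<delta>_def by (rule sum_nonneg) simp
    have rr: "(1 - \<delta> n) * h n \<le> w i - averaging (K n) w i" "w i - averaging (K n) w i \<le> (1 + \<delta> n) * h n" for n i
      using \<delta>[of n i] h(1)[of n] by (auto simp: r_def field_simps abs_le_iff)
    have bounds: "(1 - \<delta> n) * h n * (\<Sum>k. z n k) \<le> w i0" "w i0 \<le> (1 + \<delta> n) * h n * (\<Sum>k. z n k)" for n
      unfolding z_def by (rule substochastic_resolvent[where K="K n" for n, OF K_nonneg K_row \<theta> rr])+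
    have lower: "w i0 / (1 + \<delta> n) \<le> S n" for n
      using bounds(2)[of n] \<delta>_nonneg[of n] by (simp add: S_def field_simps)
    have "\<forall>\<^sub>F n in sequentially. \<delta> n < 1" using \<delta>_lim by (rule order_tendstoD) simp
    then have upper: "\<forall>\<^sub>F n in sequentially. S n \<le> w i0 / (1 - \<delta> n)"
    proof eventually_elim
      case (elim n)
      then show ?case using bounds(1)[of n] by (simp add: S_def field_simps)
    qed
    show ?thesis
    proof (rule tendsto_sandwich[OF always_eventually[rule_format, OF lower] upper])
      have "(\<lambda>n. w i0 / (1 + \<delta> n)) \<longlonglongrightarrow> w i0 / (1 + 0)"
        by (intro tendsto_intros \<delta>_lim) simp
      then show "(\<lambda>n. w i0 / (1 + \<delta> n)) \<longlonglongrightarrow> w i0" by simp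
      have "(\<lambda>n. w i0 / (1 - \<delta> n)) \<longlonglongrightarrow> w i0 / (1 - 0)"
        by (intro tendsto_intros \<delta>_lim) simp
      then show "(\<lambda>n. w i0 / (1 - \<delta> n)) \<longlonglongrightarrow> w i0" by simp
    qed
  qed
  have "0 \<le> S n" for n
    unfolding S_def using h(1)[of n] z_nonneg z_summable by (intro mult_nonneg_nonneg suminf_nonneg) auto
  then have w_nonneg: "0 \<le> w i0" using S_lim by (intro LIMSEQ_le_const[OF S_lim]) auto

  \<comment> \<open>The same quantity is the integral of the discretized survival probability.\<close>
  define g where "g n t = z n (cell (h n) t) * indicator {0<..} t" for n t
  have g_meas: "g n \<in> borel_measurable lborel" for n
    unfolding g_def cell_def by measurable
  have g_lim: "(\<lambda>n. g n t) \<longlonglongrightarrow> G t * indicator {0<..} t" for t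
  proof (cases "0 < t")
    case True
    have "(\<lambda>n. z n (cell (h n) t)) \<longlonglongrightarrow> G t"
      unfolding z_def K_def G_def
      by (rule survival_limit[OF \<open>prob_space M\<close> X poisson less_imp_le[OF m] step h(1) h_lim True])
    then show ?thesis using True by (simp add: g_def)
  qed (simp add: g_def)
  have G_meas: "(\<lambda>t. G t * indicator {0<..} t) \<in> borel_measurable lborel"
    by (rule borel_measurable_LIMSEQ_real[OF g_lim g_meas])
  \<comment> \<open>The discretized time lags behind \<open>t\<close> by at most one mesh size, hence at most 1; this is where
    the factor \<open>exp c\<close> comes from.\<close>
  have g_bound: "g n t \<le> exp c * exp (- c * t) * indicator {0..} t" for n t
  proof (cases "0 < t")
    case True
    have "z n (cell (h n) t) \<le> exp (- (real (cell (h n) t) * h n * c))"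
      using z_bound[of n "cell (h n) t"] by (simp add: exp_of_nat_mult[symmetric] mult.assoc)
    also have "\<dots> \<le> exp (c - c * t)"
    proof -
      have "t - 1 \<le> real (cell (h n) t) * h n"
        using cell_upper[OF h(1) True, of n] h(2)[of n] by (simp add: algebra_simps)
      then have "(t - 1) * c \<le> real (cell (h n) t) * h n * c" using c(1) by (intro mult_right_mono) auto
      then show ?thesis by (simp add: algebra_simps)
    qed
    finally show ?thesis using True by (simp add: g_def exp_diff exp_minus field_simps)
  qed (auto simp: g_def indicator_def)
  have exp_int: "(\<integral>\<^sup>+t. ennreal (exp c * exp (- c * t) * indicator {0..} t) \<partial>lborel) < \<infinity>"
  proof -
    have lim: "((\<lambda>t. - (exp c / c) * exp (- c * t)) \<longlongrightarrow> 0) at_top"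
    proof -
      have "filterlim (\<lambda>t. - c * t) at_bot at_top"
        by (rule filterlim_tendsto_neg_mult_at_bot[OF tendsto_const _ filterlim_ident]) (use c(1) in simp)
      then show ?thesis by (intro tendsto_mult_right_zero filterlim_compose[OF exp_at_bot])
    qed
    have "(\<integral>\<^sup>+t. ennreal (exp c * exp (- c * t)) * indicator {0..} t \<partial>lborel)
       = ennreal (0 - (- (exp c / c) * exp (- c * 0)))"
      using c(1) by (intro nn_integral_FTC_atLeast lim) (auto intro!: derivative_eq_intros)
    moreover have "(\<integral>\<^sup>+t. ennreal (exp c * exp (- c * t) * indicator {0..} t) \<partial>lborel)
      = (\<integral>\<^sup>+t. ennreal (exp c * exp (- c * t)) * indicator {0..} t \<partial>lborel)"
      by (intro nn_integral_cong) (auto simp: indicator_def)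
    ultimately show ?thesis by simp
  qed
  have "(\<lambda>n. \<integral>\<^sup>+t. ennreal (g n t) \<partial>lborel) \<longlonglongrightarrow> (\<integral>\<^sup>+t. ennreal (G t * indicator {0<..} t) \<partial>lborel)"
    by (rule nn_integral_dominated_convergence[where w="\<lambda>t. ennreal (exp c * exp (- c * t) * indicator {0..} t)"])
       (use g_meas G_meas g_bound exp_int g_lim in
         \<open>auto intro!: ennreal_leI tendsto_ennrealI simp del: ennreal_mult''\<close>)
  moreover have "(\<integral>\<^sup>+t. ennreal (g n t) \<partial>lborel) = ennreal (S n)" for n
    unfolding g_def S_def by (rule nn_integral_cells[OF h(1) z_nonneg z_summable])
  ultimately have "(\<lambda>n. ennreal (S n)) \<longlonglongrightarrow> (\<integral>\<^sup>+t. ennreal (G t * indicator {0<..} t) \<partial>lborel)"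
    by simp
  then have G_int: "(\<integral>\<^sup>+t. ennreal (G t * indicator {0<..} t) \<partial>lborel) = ennreal (w i0)"
    using tendsto_ennrealI[OF S_lim] by (rule LIMSEQ_unique)

  have "(\<integral>\<^sup>+\<omega>. first_visit N \<omega> \<partial>M) =
    (\<integral>\<^sup>+t. emeasure M {\<omega> \<in> space M. ennreal t < first_visit N \<omega>} * indicator {0..} t \<partial>lborel)"
    by (rule nn_integral_tail[OF sigma_finite_measure_axioms first_visit_measurable[OF poisson]])
  also have "\<dots> = (\<integral>\<^sup>+t. ennreal (G t * indicator {0<..} t) \<partial>lborel)"
  proof (rule nn_integral_cong_AE)
    have "AE t in lborel. t \<noteq> (0::real)" by (rule AE_lborel_singleton)
    then show "AE t in lborel. emeasure M {\<omega> \<in> space M. ennreal t < first_visit N \<omega>} * indicator {0..} t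
       = ennreal (G t * indicator {0<..} t)"
    proof eventually_elim
      case (elim t)
      show ?case
      proof (cases "0 < t")
        case True
        then have "{\<omega> \<in> space M. ennreal t < first_visit N \<omega>} = {\<omega> \<in> space M. N t \<omega> = 0}"
          using less_first_visit_iff[OF poisson] by auto
        then show ?thesis using True by (simp add: G_def emeasure_eq_measure)
      qed (use elim in auto)
    qed
  qed
  finally show ?thesis using w_nonneg by (simp add: mean_sojourn_def G_int)
qed

section \<open>Two environments and the joining game\<close>

text \<open>
  Cramer's rule for the two first-step equations; the common denominator is the determinant of \<open>m - Q\<close>.
\<close>

lemma mean_sojourn_env:
  fixes mu :: "env \<Rightarrow> real" and q :: "env \<Rightarrow> env \<Rightarrow> real"
  assumes "prob_space M" "ctmc M X e q" "modulated_poisson M X mu N"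
    and mu: "\<And>e. 0 < mu e" and q: "0 < q Env1 Env2" "0 < q Env2 Env1"
  shows "mean_sojourn M N =
    (mu (if e = Env1 then Env2 else Env1) + q Env2 Env1 + q Env1 Env2) /
    (mu Env1 * mu Env2 + mu Env1 * q Env2 Env1 + mu Env2 * q Env1 Env2)"
proof -
  define D where "D = mu Env1 * mu Env2 + mu Env1 * q Env2 Env1 + mu Env2 * q Env1 Env2"
  have D: "0 < D" unfolding D_def using mu q by (intro add_pos_pos mult_pos_pos)
  define w where "w e = (mu (if e = Env1 then Env2 else Env1) + q Env2 Env1 + q Env1 Env2) / D" for e
  have comp: "- {Env1} = {Env2}" "- {Env2} = {Env1}" using UNIV_env by auto
  have "mu i * w i - (\<Sum>j\<in>-{i}. q i j * (w j - w i)) = 1" for i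
  proof -
    have "D * (mu i * w i - (\<Sum>j\<in>-{i}. q i j * (w j - w i))) = D"
      using D by (cases i) (simp_all add: comp w_def diff_divide_distrib[symmetric], simp_all add: D_def algebra_simps)
    then show ?thesis using D by simp
  qed
  from mean_sojourn_first_step[OF assms(1-3) mu this] show ?thesis
    by (simp add: w_def D_def)
qed

text \<open>
  The payoff is a sum of one term per environment, linear in the joining probability there, and it ignores
  the other customers. Hence a dominant strategy maximizes each term separately over \<open>[0, 1]\<close>.
\<close>

lemma dominant_payoff_iff:
  assumes p: "\<And>e. 0 < p_arrival lam q e"
  shows "dominant (payoff lam q R C ES) s \<longleftrightarrow> s \<in> strategies \<and>
    (\<forall>e. (C * ES e < R \<longrightarrow> join_prob s e = 1) \<and> (R < C * ES e \<longrightarrow> join_prob s e = 0))"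
proof -
  define b where "b e = p_arrival lam q e * (R - C * ES e)" for e
  have payoff: "payoff lam q R C ES s s' = fst s * b Env1 + snd s * b Env2" for s s'
    by (cases s) (simp add: payoff_def UNIV_env b_def mult_ac)
  have b_sign: "0 < b e \<longleftrightarrow> C * ES e < R" "b e < 0 \<longleftrightarrow> R < C * ES e" for e
    using p[of e] by (auto simp: b_def zero_less_mult_iff mult_less_0_iff)
  have best: "(\<forall>y\<in>{0..1}. y * c \<le> x * c) \<longleftrightarrow> (0 < c \<longrightarrow> x = 1) \<and> (c < 0 \<longrightarrow> x = 0)"
    if "x \<in> {0..1}" for x c :: real
  proof
    assume *: "\<forall>y\<in>{0..1}. y * c \<le> x * c"
    have "0 * c \<le> x * c" "1 * c \<le> x * c" using * by (blast intro: atLeastAtMost_iff[THEN iffD2] order_refl zero_le_one)+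
    then show "(0 < c \<longrightarrow> x = 1) \<and> (c < 0 \<longrightarrow> x = 0)"
      using that by (auto simp: mult_le_cancel_right zero_le_mult_iff)
  next
    assume *: "(0 < c \<longrightarrow> x = 1) \<and> (c < 0 \<longrightarrow> x = 0)"
    show "\<forall>y\<in>{0..1}. y * c \<le> x * c"
      using * by (cases c "0::real" rule: linorder_cases) (auto simp: mult_nonneg_nonpos)
  qed
  obtain x1 x2 where s: "s = (x1, x2)" by (cases s)
  have "dominant (payoff lam q R C ES) s \<longleftrightarrow> s \<in> strategies \<and>
    (\<forall>y1\<in>{0..1}. \<forall>y2\<in>{0..1}. y1 * b Env1 + y2 * b Env2 \<le> x1 * b Env1 + x2 * b Env2)"
    by (auto simp: dominant_def payoff s strategies_def)
  also have "\<dots> \<longleftrightarrow> s \<in> strategies \<and> (\<forall>y\<in>{0..1}. y * b Env1 \<le> x1 * b Env1) \<and>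
    (\<forall>y\<in>{0..1}. y * b Env2 \<le> x2 * b Env2)"
  proof -
    have "y * b Env1 \<le> x1 * b Env1 \<and> y * b Env2 \<le> x2 * b Env2"
      if all: "\<forall>y1\<in>{0..1}. \<forall>y2\<in>{0..1}. y1 * b Env1 + y2 * b Env2 \<le> x1 * b Env1 + x2 * b Env2"
        and x: "x1 \<in> {0..1}" "x2 \<in> {0..1}" and y: "y \<in> {0..1}" for y
      using all[rule_format, OF y x(2)] all[rule_format, OF x(1) y] by simp
    \<comment> \<open>Each environment is isolated by deviating in that environment only.\<close>
    then show ?thesis by (auto simp: strategies_def s intro: add_mono)
  qed
  also have "\<dots> \<longleftrightarrow> s \<in> strategies \<and>
    (\<forall>e. (C * ES e < R \<longrightarrow> join_prob s e = 1) \<and> (R < C * ES e \<longrightarrow> join_prob s e = 0))"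
  proof (cases "s \<in> strategies")
    case True
    then have x: "x1 \<in> {0..1}" "x2 \<in> {0..1}" by (auto simp: s strategies_def)
    have "(\<forall>e. P e) \<longleftrightarrow> P Env1 \<and> P Env2" for P by (metis env.exhaust)
    then show ?thesis unfolding best[OF x(1)] best[OF x(2)] b_sign by (simp add: s)
  qed simp
  finally show ?thesis .
qed

theorem theorem3p2:
  fixes lam mu :: "env \<Rightarrow> real" and q :: "env \<Rightarrow> env \<Rightarrow> real" and R C :: real
    and M :: "env \<Rightarrow> 'a measure"
    and X :: "env \<Rightarrow> real \<Rightarrow> 'a \<Rightarrow> env"
    and N :: "env \<Rightarrow> real \<Rightarrow> 'a \<Rightarrow> nat"
    and U :: "strategy \<Rightarrow> strategy \<Rightarrow> real"
  assumes "\<And>e. lam e > 0" and "\<And>e. mu e > 0"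
    and "q Env1 Env2 > 0" and "q Env2 Env1 > 0"
    and "R > 0" and "C > 0"
    and "\<And>e. prob_space (M e)"
    and "\<And>e. ctmc (M e) (X e) e q"
    and "\<And>e. modulated_poisson (M e) (X e) mu (N e)"
  defines "U \<equiv> payoff lam q R C (\<lambda>e. mean_sojourn (M e) (N e))"
  shows "(\<exists>s. dominant U s) \<and>
    (mu Env1 \<noteq> mu Env2 \<longrightarrow>
       Vau_min mu q < Vau_max mu q \<and>
       (R / C < Vau_min mu q \<longrightarrow> {s. dominant U s} = {(0, 0)}) \<and>
       (R / C = Vau_min mu q \<longrightarrow>
          (mu Env1 < mu Env2 \<longrightarrow> {s. dominant U s} = {(0, q2) | q2. q2 \<in> {0..1}}) \<and>
          (mu Env1 > mu Env2 \<longrightarrow> {s. dominant U s} = {(q1, 0) | q1. q1 \<in> {0..1}})) \<and>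
       (Vau_min mu q < R / C \<and> R / C < Vau_max mu q \<longrightarrow>
          (mu Env1 < mu Env2 \<longrightarrow> {s. dominant U s} = {(0, 1)}) \<and>
          (mu Env1 > mu Env2 \<longrightarrow> {s. dominant U s} = {(1, 0)})) \<and>
       (R / C = Vau_max mu q \<longrightarrow>
          (mu Env1 < mu Env2 \<longrightarrow> {s. dominant U s} = {(q1, 1) | q1. q1 \<in> {0..1}}) \<and>
          (mu Env1 > mu Env2 \<longrightarrow> {s. dominant U s} = {(1, q2) | q2. q2 \<in> {0..1}})) \<and>
       (R / C > Vau_max mu q \<longrightarrow> {s. dominant U s} = {(1, 1)})) \<and>
    (mu Env1 = mu Env2 \<longrightarrow>
       Vau_min mu q = Vau_max mu q \<and>
       (R / C < Vau_min mu q \<longrightarrow> {s. dominant U s} = {(0, 0)}) \<and>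
       (R / C = Vau_min mu q \<longrightarrow>
          {s. dominant U s} = {(q1, q2) | q1 q2. q1 \<in> {0..1} \<and> q2 \<in> {0..1}}) \<and>
       (R / C > Vau_min mu q \<longrightarrow> {s. dominant U s} = {(1, 1)}))"
proof -
  define D where "D = mu Env1 * mu Env2 + mu Env1 * q Env2 Env1 + mu Env2 * q Env1 Env2"
  have D: "0 < D" unfolding D_def using assms(2-4) by (intro add_pos_pos mult_pos_pos)
  define W where "W e = (mu (if e = Env1 then Env2 else Env1) + q Env2 Env1 + q Env1 Env2) / D" for e
  have ES: "mean_sojourn (M e) (N e) = W e" for e
    unfolding W_def D_def by (rule mean_sojourn_env) (fact assms)+
  have "0 < p_env q e" for e using assms(3,4) by (cases e) auto
  then have "0 < p_arrival lam q e" for e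
    unfolding p_arrival_def using assms(1) by (intro divide_pos_pos add_pos_pos mult_pos_pos)
  note dom_iff = dominant_payoff_iff[OF this]
  have dom: "dominant U (x, y) \<longleftrightarrow> x \<in> {0..1} \<and> y \<in> {0..1} \<and>
      (W Env1 < R / C \<longrightarrow> x = 1) \<and> (R / C < W Env1 \<longrightarrow> x = 0) \<and>
      (W Env2 < R / C \<longrightarrow> y = 1) \<and> (R / C < W Env2 \<longrightarrow> y = 0)" for x y
  proof -
    have all_env: "(\<forall>e. P e) \<longleftrightarrow> P Env1 \<and> P Env2" for P by (metis env.exhaust)
    show ?thesis
      unfolding U_def using assms(6)
      by (auto simp: dom_iff all_env ES strategies_def field_simps)
  qed
  \<comment> \<open>The slower environment has the longer mean sojourn time, as the numerator contains the rate of the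
    other one.\<close>
  have V: "Vau_min mu q = min (W Env1) (W Env2)" "Vau_max mu q = max (W Env1) (W Env2)"
    using D unfolding Vau_min_def Vau_max_def W_def D_def[symmetric]
    by (auto simp: min_def max_def divide_le_cancel)
  have less: "W Env2 < W Env1 \<longleftrightarrow> mu Env1 < mu Env2" "W Env1 < W Env2 \<longleftrightarrow> mu Env2 < mu Env1"
    using D by (auto simp: W_def divide_less_cancel)
  define best where "best v = {x \<in> {0..1::real}. (v < R / C \<longrightarrow> x = 1) \<and> (R / C < v \<longrightarrow> x = 0)}" for v
  have best: "v < R / C \<Longrightarrow> best v = {1}" "R / C < v \<Longrightarrow> best v = {0}" "v = R / C \<Longrightarrow> best v = {0..1}" for v
    by (auto simp: best_def)
  have dom_set: "{s. dominant U s} = best (W Env1) \<times> best (W Env2)"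
    by (auto simp: dom best_def)
  have "(if v < R / C then 1 else 0) \<in> best v" for v by (auto simp: best_def)
  then have ex: "\<exists>s. dominant U s" using dom_set by blast
  consider "mu Env1 < mu Env2" "W Env2 < W Env1" | "mu Env2 < mu Env1" "W Env1 < W Env2"
    | "mu Env1 = mu Env2" "W Env1 = W Env2"
    using less by (metis linorder_less_linear)
  then show ?thesis
  proof cases
    case 1
    then show ?thesis
      using ex by (auto simp: V dom_set best min_def max_def)
  next
    case 2
    then show ?thesis
      using ex by (auto simp: V dom_set best min_def max_def)
  next
    case 3
    then show ?thesis
      using ex by (auto simp: V dom_set best)
  qed
qed

end
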